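(* For every associative ring $R$ with unit, the Goldie torsion theory for right $R$-modules is differential.
   Context: Modules are right modules. A derivation on $R$ is an additive map $\delta:R\to R$ with $\delta(rs)=\delta(r)s+r\delta(s)$ for all $r,s\in R$. Given a derivation $\delta$ on $R$, a $\delta$-derivation on a right $R$-module $M$ is an additive map $d:M\to M$ with $d(xr)=d(x)r+x\delta(r)$ for all $x\in M$, $r\in R$. For $m$ in a right module put $\mathrm{ann}(m)=\{r\in R: mr=0\}$, and for a right ideal $I$ and $r\in R$ put $(I:r)=\{s\in R: rs\in I\}$. Write $I\subseteq_e R$ if $I$ is an essential right ideal of $R$. The Goldie torsion theory is the hereditary torsion theory whose torsion-free class is the class of nonsingular right $R$-modules (modules in which no nonzero element has essential annihilator). Its Gabriel filter is $$\mathfrak{F}_G=\{I \text{ right ideal of } R : \{r\in R: (I:r)\subseteq_e R\}\subseteq_e R\}.$$ The torsion submodule of $M$ is $\mathcal{T}M=\{m\in M:\mathrm{ann}(m)\in\mathfrak{F}_G\}$. A hereditary torsion theory with Gabriel filter $\mathfrak{F}$ and torsion submodules $\mathcal{T}M$ is differential if for every derivation $\delta$ on $R$ and every $I\in\mathfrak{F}$ there is $J\in\mathfrak{F}$ with $\delta(J)\subseteq I$. Equivalently, $d(\mathcal{T}M)\subseteq\mathcal{T}M$ for every right $R$-module $M$, every derivation $\delta$ on $R$ and every $\delta$-derivation $d$ on $M$. *)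

theory Defs
  imports "HOL-Algebra.Ideal"
begin

definition right_ideal :: "('a, 'b) ring_scheme \<Rightarrow> 'a set \<Rightarrow> bool" where
  "right_ideal R I \<longleftrightarrow>
     additive_subgroup I R \<and> (\<forall>x\<in>I. \<forall>r\<in>carrier R. x \<otimes>\<^bsub>R\<^esub> r \<in> I)"

definition essential_right_ideal :: "('a, 'b) ring_scheme \<Rightarrow> 'a set \<Rightarrow> bool" where
  "essential_right_ideal R I \<longleftrightarrow>
     right_ideal R I \<and>
     (\<forall>A. right_ideal R A \<and> A \<noteq> {\<zero>\<^bsub>R\<^esub>} \<longrightarrow> I \<inter> A \<noteq> {\<zero>\<^bsub>R\<^esub>})"

definition right_colon :: "('a, 'b) ring_scheme \<Rightarrow> 'a set \<Rightarrow> 'a \<Rightarrow> 'a set" where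
  "right_colon R I r = {s \<in> carrier R. r \<otimes>\<^bsub>R\<^esub> s \<in> I}"

text \<open>Outside the carrier the values of the function are irrelevant.\<close>

definition ring_derivation :: "('a, 'b) ring_scheme \<Rightarrow> ('a \<Rightarrow> 'a) \<Rightarrow> bool" where
  "ring_derivation R \<delta> \<longleftrightarrow>
     \<delta> \<in> carrier R \<rightarrow> carrier R \<and>
     (\<forall>r\<in>carrier R. \<forall>s\<in>carrier R.
        \<delta> (r \<oplus>\<^bsub>R\<^esub> s) = \<delta> r \<oplus>\<^bsub>R\<^esub> \<delta> s \<and>
        \<delta> (r \<otimes>\<^bsub>R\<^esub> s) = (\<delta> r \<otimes>\<^bsub>R\<^esub> s) \<oplus>\<^bsub>R\<^esub> (r \<otimes>\<^bsub>R\<^esub> \<delta> s))"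

text \<open>
  A hereditary torsion theory for right modules is represented by its Gabriel
  filter. Properness is not required: the filter may contain the zero ideal.
\<close>

definition gabriel_filter :: "('a, 'b) ring_scheme \<Rightarrow> 'a set set \<Rightarrow> bool" where
  "gabriel_filter R F \<longleftrightarrow>
     F \<noteq> {} \<and>
     (\<forall>I\<in>F. right_ideal R I) \<and>
     (\<forall>I\<in>F. \<forall>J. right_ideal R J \<and> I \<subseteq> J \<longrightarrow> J \<in> F) \<and>
     (\<forall>I\<in>F. \<forall>J\<in>F. I \<inter> J \<in> F) \<and>
     (\<forall>I\<in>F. \<forall>r\<in>carrier R. right_colon R I r \<in> F) \<and>
     (\<forall>I. right_ideal R I \<and> (\<exists>J\<in>F. \<forall>r\<in>J. right_colon R I r \<in> F) \<longrightarrow> I \<in> F)"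

definition differential_torsion_theory :: "('a, 'b) ring_scheme \<Rightarrow> 'a set set \<Rightarrow> bool" where
  "differential_torsion_theory R F \<longleftrightarrow>
     gabriel_filter R F \<and>
     (\<forall>\<delta>. ring_derivation R \<delta> \<longrightarrow> (\<forall>I\<in>F. \<exists>J\<in>F. \<delta> ` J \<subseteq> I))"

definition goldie_filter :: "('a, 'b) ring_scheme \<Rightarrow> 'a set set" where
  "goldie_filter R =
     {I. right_ideal R I \<and>
         essential_right_ideal R {r \<in> carrier R. essential_right_ideal R (right_colon R I r)}}"

end

theory Submission
  imports Defs
begin

text \<open>
  The differential condition holds for \<^emph>\<open>every\<close> Gabriel filter \<open>F\<close>, so the only thing special
  to the Goldie theory is that its filter is a Gabriel filter.

  Given \<open>I \<in> F\<close> and a derivation \<open>\<delta>\<close>, take \<open>J = I \<inter> \<delta>\<^sup>-\<^sup>1(I)\<close>. Although \<open>\<delta>\<close> is not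
  linear, \<open>J\<close> is a right ideal: for \<open>x \<in> J\<close> the error term \<open>x \<delta>(r)\<close> in \<open>\<delta>(x r)\<close> lies in \<open>I\<close>
  because \<open>x\<close> does. For the same reason \<open>(J : x) = (I : \<delta>(x))\<close> for every \<open>x \<in> I\<close>, so all these
  colon ideals are in \<open>F\<close>, and closure of \<open>F\<close> under extensions yields \<open>J \<in> F\<close>
  (lemma \<open>gabriel_filter_differential\<close>).

  For the Goldie filter, write \<open>D(I)\<close> for the preimage in \<open>R\<close> of the singular submodule of
  \<open>R/I\<close>, so that \<open>I\<close> belongs to the filter iff \<open>D(I)\<close> is essential. The operator \<open>D\<close> is
  monotone and commutes with intersections and colons, which gives all the axioms but closure
  under extensions. If \<open>J\<close> is in the filter and every \<open>(I : r)\<close> with \<open>r \<in> J\<close> is too, then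
  \<open>J \<subseteq> D(D(I))\<close>, hence \<open>D(D(D(I)))\<close> is essential. It remains to peel off two applications of
  \<open>D\<close>, which is possible because \<open>D(K)\<close> essential forces \<open>K\<close> essential as soon as \<open>K\<close> contains
  the right singular ideal \<open>D(0)\<close> (lemma \<open>essential_if_singular_preimage_essential\<close>).
\<close>

section \<open>Right ideals and their colons\<close>

text \<open>
  The annihilator of \<open>r + I\<close> in \<open>R/I\<close> is \<open>(I : r)\<close>; so this is the preimage in \<open>R\<close> of the
  singular submodule of \<open>R/I\<close>. For \<open>I = 0\<close> it is the right singular ideal of \<open>R\<close>.
\<close>

definition singular_preimage :: "('a, 'b) ring_scheme \<Rightarrow> 'a set \<Rightarrow> 'a set" where
  "singular_preimage R I = {r \<in> carrier R. essential_right_ideal R (right_colon R I r)}"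

lemma goldie_filter_iff:
  "I \<in> goldie_filter R \<longleftrightarrow> right_ideal R I \<and> essential_right_ideal R (singular_preimage R I)"
  by (simp add: goldie_filter_def singular_preimage_def)

context ring
begin

lemma right_idealI:
  assumes "I \<subseteq> carrier R" "\<zero> \<in> I" "\<And>x y. x \<in> I \<Longrightarrow> y \<in> I \<Longrightarrow> x \<oplus> y \<in> I"
    and mult: "\<And>x r. x \<in> I \<Longrightarrow> r \<in> carrier R \<Longrightarrow> x \<otimes> r \<in> I"
  shows "right_ideal R I"
proof -
  \<comment> \<open>Closure under negation comes from multiplication by \<open>- 1\<close>.\<close>
  have "\<ominus> x \<in> I" if "x \<in> I" for x
    using mult[OF that, of "\<ominus> \<one>"] that assms(1) by (auto simp: r_minus)
  with assms(1-3) have "subgroup I (add_monoid R)"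
    by (auto intro!: subgroup.intro simp flip: a_inv_def)
  with mult show ?thesis
    by (auto simp: right_ideal_def intro: additive_subgroupI)
qed

lemma right_ideal_closed:
  assumes "right_ideal R I"
  shows "x \<in> I \<Longrightarrow> x \<in> carrier R" "\<zero> \<in> I"
    "x \<in> I \<Longrightarrow> y \<in> I \<Longrightarrow> x \<oplus> y \<in> I"
    "x \<in> I \<Longrightarrow> r \<in> carrier R \<Longrightarrow> x \<otimes> r \<in> I"
  using assms additive_subgroup.a_Hcarr additive_subgroup.zero_closed
    additive_subgroup.a_closed
  unfolding right_ideal_def by fast+

lemma right_ideal_diff_closed:
  assumes "right_ideal R I" "x \<oplus> y \<in> I" "y \<in> I" "x \<in> carrier R"
  shows "x \<in> I"
proof -
  note cl = right_ideal_closed[OF assms(1)]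
  have y: "y \<in> carrier R" using assms(3) by (rule cl)
  have "y \<otimes> \<ominus> \<one> \<in> I" using assms(3) by (rule cl) simp
  then have "\<ominus> y \<in> I" using y by (simp add: r_minus)
  with assms(2) have "(x \<oplus> y) \<oplus> \<ominus> y \<in> I" by (rule cl)
  then show ?thesis using y assms(4) by (simp add: a_assoc r_neg)
qed

lemma right_ideal_zero: "right_ideal R {\<zero>}"
  by (rule right_idealI) auto

lemma right_ideal_carrier: "right_ideal R (carrier R)"
  by (rule right_idealI) auto

lemma right_ideal_Int:
  "right_ideal R I \<Longrightarrow> right_ideal R J \<Longrightarrow> right_ideal R (I \<inter> J)"
  by (rule right_idealI) (auto intro: right_ideal_closed)

lemma right_ideal_colon:
  assumes "right_ideal R I" "r \<in> carrier R"
  shows "right_ideal R (right_colon R I r)"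
  using right_ideal_closed[OF assms(1)] assms(2)
  by (intro right_idealI) (auto simp: right_colon_def r_distr simp flip: m_assoc)

lemma right_ideal_principal:
  assumes "a \<in> carrier R"
  shows "right_ideal R ((\<otimes>) a ` carrier R)"
proof (rule right_idealI)
  show "\<zero> \<in> (\<otimes>) a ` carrier R"
    using assms by (auto intro!: image_eqI[of _ _ \<zero>])
qed (use assms in \<open>auto simp: m_assoc simp flip: r_distr\<close>)

lemma right_colon_colon:
  assumes "r \<in> carrier R" "s \<in> carrier R"
  shows "right_colon R (right_colon R I r) s = right_colon R I (r \<otimes> s)"
  using assms by (auto simp: right_colon_def m_assoc)


section \<open>Essential right ideals\<close>

text \<open>
  Testing against principal right ideals suffices. This turns essentiality into a statement about
  elements, in which form it is easy to transfer along colons and intersections.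
\<close>

lemma essential_right_ideal_iff:
  "essential_right_ideal R I \<longleftrightarrow>
     right_ideal R I \<and>
     (\<forall>a\<in>carrier R. a \<noteq> \<zero> \<longrightarrow> (\<exists>r\<in>carrier R. a \<otimes> r \<in> I \<and> a \<otimes> r \<noteq> \<zero>))"
    (is "_ \<longleftrightarrow> _ \<and> ?elem")
proof (cases "right_ideal R I")
  case I: True
  note zero = right_ideal_closed(2)
  have "?elem \<longleftrightarrow> (\<forall>A. right_ideal R A \<and> A \<noteq> {\<zero>} \<longrightarrow> I \<inter> A \<noteq> {\<zero>})"
  proof (intro iffI ballI allI impI)
    fix A assume elem: ?elem and A: "right_ideal R A \<and> A \<noteq> {\<zero>}"
    then obtain a where "a \<in> A" "a \<noteq> \<zero>" using zero by blast
    with elem A right_ideal_closed(1,4)[of A] show "I \<inter> A \<noteq> {\<zero>}" by fast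
  next
    fix a assume ess: "\<forall>A. right_ideal R A \<and> A \<noteq> {\<zero>} \<longrightarrow> I \<inter> A \<noteq> {\<zero>}"
      and a: "a \<in> carrier R" "a \<noteq> \<zero>"
    let ?A = "(\<otimes>) a ` carrier R"
    have A: "right_ideal R ?A" using a(1) by (rule right_ideal_principal)
    have "a \<in> ?A" using a by (auto intro!: image_eqI[of _ _ \<one>])
    with A a ess have "I \<inter> ?A \<noteq> {\<zero>}" by blast
    moreover have "\<zero> \<in> I \<inter> ?A" using zero[OF I] zero[OF A] by simp
    ultimately show "\<exists>r\<in>carrier R. a \<otimes> r \<in> I \<and> a \<otimes> r \<noteq> \<zero>" by blast
  qed
  with I show ?thesis by (simp add: essential_right_ideal_def)
qed (simp add: essential_right_ideal_def)

lemma essential_right_idealE: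
  assumes "essential_right_ideal R I" "a \<in> carrier R" "a \<noteq> \<zero>"
  obtains r where "r \<in> carrier R" "a \<otimes> r \<in> I" "a \<otimes> r \<noteq> \<zero>"
  using assms essential_right_ideal_iff by blast

lemma essential_imp_right_ideal: "essential_right_ideal R I \<Longrightarrow> right_ideal R I"
  by (simp add: essential_right_ideal_def)

lemma essential_right_ideal_mono:
  assumes "essential_right_ideal R I" "right_ideal R J" "I \<subseteq> J"
  shows "essential_right_ideal R J"
  using assms essential_right_ideal_iff by blast

lemma essential_right_ideal_carrier: "essential_right_ideal R (carrier R)"
  unfolding essential_right_ideal_iff
  using right_ideal_carrier by (auto intro!: bexI[of _ \<one>])

lemma essential_right_ideal_Int:
  assumes "essential_right_ideal R I" "essential_right_ideal R J"
  shows "essential_right_ideal R (I \<inter> J)"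
  unfolding essential_right_ideal_iff
proof (intro conjI ballI impI)
  show "right_ideal R (I \<inter> J)"
    using assms by (intro right_ideal_Int essential_imp_right_ideal)
  fix a assume a: "a \<in> carrier R" "a \<noteq> \<zero>"
  then obtain r where r: "r \<in> carrier R" "a \<otimes> r \<in> I" "a \<otimes> r \<noteq> \<zero>"
    using essential_right_idealE[OF assms(1)] by blast
  then obtain s where "s \<in> carrier R" "a \<otimes> r \<otimes> s \<in> J" "a \<otimes> r \<otimes> s \<noteq> \<zero>"
    using essential_right_idealE[OF assms(2), of "a \<otimes> r"] a by blast
  moreover from this r have "a \<otimes> r \<otimes> s \<in> I"
    using right_ideal_closed(4)[OF essential_imp_right_ideal[OF assms(1)]] by blast
  ultimately show "\<exists>t\<in>carrier R. a \<otimes> t \<in> I \<inter> J \<and> a \<otimes> t \<noteq> \<zero>"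
    using a r by (intro bexI[of _ "r \<otimes> s"]) (auto simp: m_assoc)
qed

lemma essential_right_ideal_colon:
  assumes "essential_right_ideal R I" "r \<in> carrier R"
  shows "essential_right_ideal R (right_colon R I r)"
  unfolding essential_right_ideal_iff
proof (intro conjI ballI impI)
  have I: "right_ideal R I" using assms(1) by (rule essential_imp_right_ideal)
  then show "right_ideal R (right_colon R I r)" using assms(2) by (rule right_ideal_colon)
  fix a assume a: "a \<in> carrier R" "a \<noteq> \<zero>"
  show "\<exists>s\<in>carrier R. a \<otimes> s \<in> right_colon R I r \<and> a \<otimes> s \<noteq> \<zero>"
  proof (cases "r \<otimes> a = \<zero>")
    case True
    then show ?thesis
      using a right_ideal_closed(2)[OF I]
      by (intro bexI[of _ \<one>]) (auto simp: right_colon_def)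
  next
    case False
    then obtain s where "s \<in> carrier R" "r \<otimes> a \<otimes> s \<in> I" "r \<otimes> a \<otimes> s \<noteq> \<zero>"
      using essential_right_idealE[OF assms(1), of "r \<otimes> a"] a assms(2) by blast
    then show ?thesis
      using a assms(2) by (intro bexI[of _ s]) (auto simp: right_colon_def m_assoc)
  qed
qed


section \<open>The preimage of the singular submodule of a cyclic module\<close>

lemma right_ideal_singular_preimage:
  assumes "right_ideal R I"
  shows "right_ideal R (singular_preimage R I)"
proof (rule right_idealI)
  note cl = right_ideal_closed[OF assms]
  show "singular_preimage R I \<subseteq> carrier R" by (auto simp: singular_preimage_def)
  have "right_colon R I \<zero> = carrier R" using cl by (auto simp: right_colon_def)
  then show "\<zero> \<in> singular_preimage R I"
    by (simp add: singular_preimage_def essential_right_ideal_carrier)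
next
  fix x y assume xy: "x \<in> singular_preimage R I" "y \<in> singular_preimage R I"
  then have "x \<in> carrier R" "y \<in> carrier R" by (auto simp: singular_preimage_def)
  moreover from this have "right_colon R I x \<inter> right_colon R I y \<subseteq> right_colon R I (x \<oplus> y)"
    using right_ideal_closed[OF assms] by (auto simp: right_colon_def l_distr)
  ultimately show "x \<oplus> y \<in> singular_preimage R I"
    using xy essential_right_ideal_Int essential_right_ideal_mono right_ideal_colon[OF assms]
    by (simp add: singular_preimage_def) blast
next
  fix x r assume "x \<in> singular_preimage R I" "r \<in> carrier R"
  then show "x \<otimes> r \<in> singular_preimage R I"
    using essential_right_ideal_colon
    by (auto simp: singular_preimage_def simp flip: right_colon_colon)
qed

lemma singular_preimage_mono:
  assumes "right_ideal R J" "I \<subseteq> J"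
  shows "singular_preimage R I \<subseteq> singular_preimage R J"
proof -
  have "right_colon R I r \<subseteq> right_colon R J r" for r
    using assms(2) by (auto simp: right_colon_def)
  then show ?thesis
    using essential_right_ideal_mono right_ideal_colon[OF assms(1)]
    by (auto simp: singular_preimage_def)
qed

lemma singular_preimage_Int:
  "singular_preimage R I \<inter> singular_preimage R J \<subseteq> singular_preimage R (I \<inter> J)"
proof -
  have "right_colon R (I \<inter> J) r = right_colon R I r \<inter> right_colon R J r" for r
    by (auto simp: right_colon_def)
  then show ?thesis
    using essential_right_ideal_Int by (auto simp: singular_preimage_def)
qed

lemma singular_preimage_colon:
  assumes "r \<in> carrier R"
  shows "singular_preimage R (right_colon R I r) = right_colon R (singular_preimage R I) r"
proof (rule Set.set_eqI)
  fix s
  have "s \<in> right_colon R (singular_preimage R I) r \<longleftrightarrow>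
      s \<in> carrier R \<and> r \<otimes> s \<in> singular_preimage R I"
    by (simp add: right_colon_def)
  also have "\<dots> \<longleftrightarrow> s \<in> singular_preimage R (right_colon R I r)"
    using assms by (auto simp: singular_preimage_def right_colon_colon)
  finally show "s \<in> singular_preimage R (right_colon R I r) \<longleftrightarrow>
      s \<in> right_colon R (singular_preimage R I) r" ..
qed

text \<open>
  Suppose \<open>b \<noteq> 0\<close> lies in the singular preimage of \<open>K\<close>. The ideal \<open>b (K : b)\<close> is contained in
  \<open>K\<close>; if it vanished, the annihilator of \<open>b\<close> would contain the essential ideal \<open>(K : b)\<close>, so
  \<open>b\<close> would be a singular element and hence itself in \<open>K\<close>. Either way \<open>b R\<close> meets \<open>K\<close>
  nontrivially, so \<open>K\<close> is essential in its singular preimage.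
\<close>

lemma essential_if_singular_preimage_essential:
  assumes K: "right_ideal R K" and sing: "singular_preimage R {\<zero>} \<subseteq> K"
    and ess: "essential_right_ideal R (singular_preimage R K)"
  shows "essential_right_ideal R K"
  unfolding essential_right_ideal_iff
proof (intro conjI ballI impI)
  fix a assume a: "a \<in> carrier R" "a \<noteq> \<zero>"
  then obtain r where r: "r \<in> carrier R" "a \<otimes> r \<in> singular_preimage R K" "a \<otimes> r \<noteq> \<zero>"
    using essential_right_idealE[OF ess] by blast
  define b where "b = a \<otimes> r"
  have b: "b \<in> carrier R" "b \<noteq> \<zero>" "essential_right_ideal R (right_colon R K b)"
    using a r by (auto simp: b_def singular_preimage_def)
  have "\<exists>s\<in>carrier R. b \<otimes> s \<in> K \<and> b \<otimes> s \<noteq> \<zero>"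
  proof (rule ccontr)
    assume none: "\<not> ?thesis"
    then have "right_colon R K b \<subseteq> right_colon R {\<zero>} b"
      by (auto simp: right_colon_def)
    with b(3) have "essential_right_ideal R (right_colon R {\<zero>} b)"
      using right_ideal_colon[OF right_ideal_zero b(1)]
      by (metis essential_right_ideal_mono)
    then have "b \<in> K" using b(1) sing by (auto simp: singular_preimage_def)
    with none b(1,2) show False by (metis one_closed r_one)
  qed
  then obtain s where "s \<in> carrier R" "b \<otimes> s \<in> K" "b \<otimes> s \<noteq> \<zero>" by blast
  then show "\<exists>t\<in>carrier R. a \<otimes> t \<in> K \<and> a \<otimes> t \<noteq> \<zero>"
    using a r by (intro bexI[of _ "r \<otimes> s"]) (auto simp: b_def m_assoc)
qed (rule K)

text \<open>
  A singular preimage always contains the right singular ideal, so the previous lemma applies to it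
  whatever \<open>I\<close> is. This is the classical fact that the Goldie torsion closure is reached after
  two steps, in the form needed below.
\<close>

lemma essential_singular_preimage_cancel:
  assumes I: "right_ideal R I"
    and "essential_right_ideal R (singular_preimage R (singular_preimage R I))"
  shows "essential_right_ideal R (singular_preimage R I)"
proof (rule essential_if_singular_preimage_essential)
  show "right_ideal R (singular_preimage R I)"
    using I by (rule right_ideal_singular_preimage)
  show "singular_preimage R {\<zero>} \<subseteq> singular_preimage R I"
    using right_ideal_closed(2)[OF I] by (simp add: singular_preimage_mono[OF I])
qed (rule assms(2))


section \<open>The Goldie filter is a Gabriel filter\<close>

lemma goldie_filter_extension:
  assumes I: "right_ideal R I" and J: "J \<in> goldie_filter R"
    and colon: "\<And>r. r \<in> J \<Longrightarrow> right_colon R I r \<in> goldie_filter R"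
  shows "I \<in> goldie_filter R"
proof -
  let ?D = "singular_preimage R"
  note D = right_ideal_singular_preimage
  have "J \<subseteq> ?D (?D I)"
  proof
    fix r assume r: "r \<in> J"
    with J have "r \<in> carrier R"
      using right_ideal_closed(1) by (auto simp: goldie_filter_iff)
    with colon[OF r] show "r \<in> ?D (?D I)"
      by (simp add: goldie_filter_iff singular_preimage_colon)
        (simp add: singular_preimage_def)
  qed
  then have "?D J \<subseteq> ?D (?D (?D I))"
    by (intro singular_preimage_mono D I)
  moreover have "essential_right_ideal R (?D J)"
    using J by (simp add: goldie_filter_iff)
  ultimately have "essential_right_ideal R (?D (?D (?D I)))"
    by (rule essential_right_ideal_mono[OF _ D[OF D[OF D[OF I]]], rotated])
  then have "essential_right_ideal R (?D (?D I))"
    by (rule essential_singular_preimage_cancel[OF D[OF I]])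
  then have "essential_right_ideal R (?D I)"
    by (rule essential_singular_preimage_cancel[OF I])
  with I show ?thesis by (simp add: goldie_filter_iff)
qed

lemma gabriel_filter_goldie_filter: "gabriel_filter R (goldie_filter R)"
  unfolding gabriel_filter_def
proof (intro conjI ballI allI impI)
  have "right_colon R (carrier R) r = carrier R" if "r \<in> carrier R" for r
    using that by (auto simp: right_colon_def)
  then have "singular_preimage R (carrier R) = carrier R"
    by (auto simp: singular_preimage_def essential_right_ideal_carrier)
  then have "carrier R \<in> goldie_filter R"
    by (simp add: goldie_filter_iff right_ideal_carrier essential_right_ideal_carrier)
  then show "goldie_filter R \<noteq> {}" by blast
next
  fix I assume "I \<in> goldie_filter R"
  then show "right_ideal R I" by (simp add: goldie_filter_iff)
next
  fix I J assume "I \<in> goldie_filter R" "right_ideal R J \<and> I \<subseteq> J"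
  then have "right_ideal R J" "essential_right_ideal R (singular_preimage R I)" "I \<subseteq> J"
    by (simp_all add: goldie_filter_iff)
  then show "J \<in> goldie_filter R"
    by (simp add: goldie_filter_iff essential_right_ideal_mono[OF _ right_ideal_singular_preimage]
        singular_preimage_mono)
next
  fix I J assume "I \<in> goldie_filter R" "J \<in> goldie_filter R"
  then have "right_ideal R (I \<inter> J)"
    "essential_right_ideal R (singular_preimage R I \<inter> singular_preimage R J)"
    by (simp_all add: goldie_filter_iff right_ideal_Int essential_right_ideal_Int)
  then show "I \<inter> J \<in> goldie_filter R"
    by (simp add: goldie_filter_iff singular_preimage_Int
        essential_right_ideal_mono[OF _ right_ideal_singular_preimage])
next
  fix I r assume "I \<in> goldie_filter R" "r \<in> carrier R"
  then show "right_colon R I r \<in> goldie_filter R"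
    by (simp add: goldie_filter_iff singular_preimage_colon right_ideal_colon
        essential_right_ideal_colon)
next
  fix I
  assume "right_ideal R I \<and> (\<exists>J\<in>goldie_filter R. \<forall>r\<in>J. right_colon R I r \<in> goldie_filter R)"
  then obtain J where "right_ideal R I" "J \<in> goldie_filter R"
    "\<And>r. r \<in> J \<Longrightarrow> right_colon R I r \<in> goldie_filter R" by blast
  then show "I \<in> goldie_filter R" by (rule goldie_filter_extension)
qed


section \<open>Gabriel filters and derivations\<close>

lemma gabriel_filter_right_ideal:
  assumes "gabriel_filter R F" "I \<in> F"
  shows "right_ideal R I"
proof -
  have "\<forall>I\<in>F. right_ideal R I"
    using assms(1) unfolding gabriel_filter_def by (elim conjE)
  then show ?thesis using assms(2) by (rule bspec)
qed

lemma gabriel_filter_colon: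
  assumes "gabriel_filter R F" "I \<in> F" "r \<in> carrier R"
  shows "right_colon R I r \<in> F"
proof -
  have "\<forall>I\<in>F. \<forall>r\<in>carrier R. right_colon R I r \<in> F"
    using assms(1) unfolding gabriel_filter_def by (elim conjE)
  then show ?thesis using assms(2,3) by blast
qed

lemma gabriel_filter_extension:
  assumes "gabriel_filter R F" "right_ideal R I" "J \<in> F"
    and "\<And>r. r \<in> J \<Longrightarrow> right_colon R I r \<in> F"
  shows "I \<in> F"
proof -
  have "\<forall>I. right_ideal R I \<and> (\<exists>J\<in>F. \<forall>r\<in>J. right_colon R I r \<in> F) \<longrightarrow> I \<in> F"
    using assms(1) unfolding gabriel_filter_def by (elim conjE)
  then show ?thesis using assms(2-4) by blast
qed

lemma ring_derivation_zero:
  assumes "ring_derivation R \<delta>"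
  shows "\<delta> \<zero> = \<zero>"
proof -
  have d0: "\<delta> \<zero> \<in> carrier R" using assms by (auto simp: ring_derivation_def)
  have "\<delta> (\<zero> \<oplus> \<zero>) = \<delta> \<zero> \<oplus> \<delta> \<zero>"
    using assms zero_closed unfolding ring_derivation_def by blast
  then have "\<delta> \<zero> \<oplus> \<delta> \<zero> = \<delta> \<zero>" by simp
  then show ?thesis using add.l_cancel_one[OF d0 d0] by simp
qed

text \<open>
  The witness is \<open>J = I \<inter> \<delta>\<^sup>-\<^sup>1(I)\<close>. Modulo \<open>I\<close>, the map \<open>\<delta>\<close> is right linear on \<open>I\<close>, and \<open>J\<close>
  is its kernel; therefore \<open>(J : x) = (I : \<delta>(x))\<close> for \<open>x \<in> I\<close>, and \<open>I/J\<close> is torsion because it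
  embeds into \<open>R/I\<close>.
\<close>

lemma gabriel_filter_differential:
  assumes F: "gabriel_filter R F" and \<delta>: "ring_derivation R \<delta>" and I: "I \<in> F"
  shows "\<exists>J\<in>F. \<delta> ` J \<subseteq> I"
proof -
  have rI: "right_ideal R I" using F I by (rule gabriel_filter_right_ideal)
  note cl = right_ideal_closed[OF rI]
  have dcl: "\<delta> x \<in> carrier R" if "x \<in> carrier R" for x
    using \<delta> that by (auto simp: ring_derivation_def)
  have dadd: "\<delta> (x \<oplus> y) = \<delta> x \<oplus> \<delta> y" if "x \<in> carrier R" "y \<in> carrier R" for x y
    using \<delta> that unfolding ring_derivation_def by blast
  have dmult: "\<delta> (x \<otimes> y) = \<delta> x \<otimes> y \<oplus> x \<otimes> \<delta> y"
    if "x \<in> carrier R" "y \<in> carrier R" for x y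
    using \<delta> that unfolding ring_derivation_def by blast
  have linear_mod: "\<delta> (x \<otimes> r) \<in> I \<longleftrightarrow> \<delta> x \<otimes> r \<in> I" if "x \<in> I" "r \<in> carrier R" for x r
  proof -
    have x: "x \<in> carrier R" using that(1) by (rule cl)
    have error: "x \<otimes> \<delta> r \<in> I" by (rule cl(4)[OF that(1) dcl[OF that(2)]])
    show ?thesis
    proof
      assume "\<delta> (x \<otimes> r) \<in> I"
      then have "\<delta> x \<otimes> r \<oplus> x \<otimes> \<delta> r \<in> I" by (simp add: dmult x that)
      then show "\<delta> x \<otimes> r \<in> I"
        using error by (rule right_ideal_diff_closed[OF rI]) (simp add: dcl x that)
    next
      assume "\<delta> x \<otimes> r \<in> I"
      then show "\<delta> (x \<otimes> r) \<in> I" using error by (simp add: dmult x that cl(3))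
    qed
  qed
  define J where "J = {x \<in> I. \<delta> x \<in> I}"
  have rJ: "right_ideal R J"
  proof (rule right_idealI)
    show "J \<subseteq> carrier R" using cl(1) by (auto simp: J_def)
    show "\<zero> \<in> J" by (simp add: J_def ring_derivation_zero[OF \<delta>] cl(2))
  next
    fix x y assume "x \<in> J" "y \<in> J"
    then show "x \<oplus> y \<in> J" by (simp add: J_def dadd cl(1,3))
  next
    fix x r assume "x \<in> J" "r \<in> carrier R"
    then show "x \<otimes> r \<in> J" by (simp add: J_def linear_mod cl(4))
  qed
  have "right_colon R J x = right_colon R I (\<delta> x)" if "x \<in> I" for x
    using that by (auto simp: J_def right_colon_def linear_mod cl(4))
  moreover have "right_colon R I (\<delta> x) \<in> F" if "x \<in> I" for x
    using F I dcl[OF cl(1)[OF that]] by (rule gabriel_filter_colon)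
  ultimately have "right_colon R J x \<in> F" if "x \<in> I" for x
    using that by simp
  with F rJ I have "J \<in> F" by (rule gabriel_filter_extension)
  moreover have "\<delta> ` J \<subseteq> I" by (auto simp: J_def)
  ultimately show ?thesis by (rule bexI[rotated])
qed

end

theorem proposition14:
  fixes R (structure)
  assumes "ring R"
  shows "differential_torsion_theory R (goldie_filter R)"
proof -
  interpret ring R by fact
  show ?thesis
    unfolding differential_torsion_theory_def
    by (intro conjI allI impI ballI gabriel_filter_goldie_filter
        gabriel_filter_differential[OF gabriel_filter_goldie_filter])
qed

end
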